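(* Let $X$ be a ULF graph. The following are equivalent: (1) in $H^{\mathrm{uf}}_1(X,\mathbb{Z}_2)$, the infinite sum $\sum_{i=0}^\infty[0]$ of the zero class is consistent; (2) $X$ has no large circuits; (3) every countable sum of classes in $H^{\mathrm{uf}}_1(X,\mathbb{Z}_2)$ that admits a thin family of representatives is consistent.
   Context: A ULF graph has uniformly bounded degrees; $d$ is the graph metric. $Z^{\mathrm{suf}}_1(X,\mathbb{Z}_2)\subseteq\mathbb{Z}_2^{EX}$ is the space of edge sets with even degree at every vertex. A family in $\mathbb{Z}_2^{EX}$ is thin if each edge lies in the support of only finitely many members; its sum is then defined pointwise. A circuit is a closed path $(v_1,\dots,v_s)$ ($v_i\sim v_{i+1}$, indices mod $s$) of length $s$, identified with its edge set mod 2. $\mathcal{C}_R(X,\mathbb{Z}_2)$ is the set of sums of thin families of circuits of length $\le R$, $\mathcal{C}_\infty=\bigcup_R\mathcal{C}_R$. One has $H^{\mathrm{uf}}_1(X,\mathbb{Z}_2)\cong Z^{\mathrm{suf}}_1(X,\mathbb{Z}_2)/\mathcal{C}_\infty(X,\mathbb{Z}_2)$, where $H^{\mathrm{uf}}_1$ is the direct limit over $r$ of the simplicial homology groups $H_1(R_rX,\mathbb{Z}_2)$ of the Rips complexes $R_rX$ (simplices = finite vertex sets of pairwise distance $\le r$); we work with this quotient description. For a thin-sum space $V$ (a subspace of $\mathbb{Z}_2^{EX}$ closed under thin sums, here $V=Z^{\mathrm{suf}}_1(X,\mathbb{Z}_2)$) and a subspace $W\le V$ (here $W=\mathcal{C}_\infty$),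 a countable sum $\sum_i a_i$ of cosets $a_i\in V/W$ is consistent if there is a choice of representatives $\tilde a_i\in a_i$ forming a thin family, and any two such thin choices $\{\tilde a_i\},\{\tilde b_i\}$ satisfy $\sum_i\tilde a_i-\sum_i\tilde b_i\in W$. $X$ has large circuits if there is no $R>0$ such that every circuit is the sum of a thin family of circuits of length $\le R$. *)

theory Defs
  imports Complex_Main "HOL-Library.Z2" "HOL-Library.Function_Algebras"
    "HOL-Library.Set_Algebras" "HOL-Library.Countable_Set"
begin

definition simple_graph :: "'a set \<Rightarrow> 'a set set \<Rightarrow> bool" where
  "simple_graph V E \<longleftrightarrow> (\<forall>e\<in>E. e \<subseteq> V \<and> card e = 2)"

definition ulf_graph :: "'a set \<Rightarrow> 'a set set \<Rightarrow> bool" where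
  "ulf_graph V E \<longleftrightarrow> simple_graph V E \<and>
     (\<exists>D. \<forall>v\<in>V. finite {e\<in>E. v \<in> e} \<and> card {e\<in>E. v \<in> e} \<le> D)"

definition thin :: "'i set \<Rightarrow> ('i \<Rightarrow> 'e \<Rightarrow> bit) \<Rightarrow> bool" where
  "thin I f \<longleftrightarrow> (\<forall>e. finite {i\<in>I. f i e \<noteq> 0})"

definition thin_sum :: "'i set \<Rightarrow> ('i \<Rightarrow> 'e \<Rightarrow> bit) \<Rightarrow> 'e \<Rightarrow> bit" where
  "thin_sum I f = (\<lambda>e. \<Sum>i\<in>{i\<in>I. f i e \<noteq> 0}. f i e)"

text \<open>Elements of \<open>\<int>\<^sub>2\<^bsup>EX\<^esup>\<close> are functions on \<^typ>\<open>'a set\<close> that vanish outside \<open>E\<close>.\<close>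

definition Z1_suf :: "'a set \<Rightarrow> 'a set set \<Rightarrow> ('a set \<Rightarrow> bit) set" where
  "Z1_suf V E = {x. (\<forall>e. e \<notin> E \<longrightarrow> x e = 0) \<and>
     (\<forall>v\<in>V. even (card {e\<in>E. v \<in> e \<and> x e = 1}))}"

definition circuit :: "'a set set \<Rightarrow> 'a list \<Rightarrow> bool" where
  "circuit E vs \<longleftrightarrow> vs \<noteq> [] \<and>
     (\<forall>i<length vs. {vs ! i, vs ! (Suc i mod length vs)} \<in> E)"

definition circuit_vec :: "'a list \<Rightarrow> 'a set \<Rightarrow> bit" where
  "circuit_vec vs = (\<lambda>e. of_nat (card {i. i < length vs \<and> {vs ! i, vs ! (Suc i mod length vs)} = e}))"

text \<open>HOL cannot quantify over the index type of a family inside a definition. The index type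
  \<^typ>\<open>'a list \<times> nat\<close> is large enough: a closed path whose edge set mod 2 is nonempty occurs only
  finitely often in a thin family. See lemma \<open>thin_sum_in_C_circ\<close> for arbitrary index types.\<close>

definition C_circ :: "'a set set \<Rightarrow> nat \<Rightarrow> ('a set \<Rightarrow> bit) set" where
  "C_circ E R = {x. \<exists>(I :: ('a list \<times> nat) set) c.
     (\<forall>i\<in>I. circuit E (c i) \<and> length (c i) \<le> R) \<and>
     thin I (\<lambda>i. circuit_vec (c i)) \<and> x = thin_sum I (\<lambda>i. circuit_vec (c i))}"

definition C_inf :: "'a set set \<Rightarrow> ('a set \<Rightarrow> bit) set" where
  "C_inf E = (\<Union>R. C_circ E R)"

definition H1_uf :: "'a set \<Rightarrow> 'a set set \<Rightarrow> ('a set \<Rightarrow> bit) set set" where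
  "H1_uf V E = (\<lambda>z. z +o C_inf E) ` Z1_suf V E"

definition thin_choice ::
    "'i set \<Rightarrow> ('i \<Rightarrow> ('e \<Rightarrow> bit) set) \<Rightarrow> ('i \<Rightarrow> 'e \<Rightarrow> bit) \<Rightarrow> bool" where
  "thin_choice I a r \<longleftrightarrow> (\<forall>i\<in>I. r i \<in> a i) \<and> thin I r"

definition consistent_sum ::
    "('e \<Rightarrow> bit) set \<Rightarrow> 'i set \<Rightarrow> ('i \<Rightarrow> ('e \<Rightarrow> bit) set) \<Rightarrow> bool" where
  "consistent_sum W I a \<longleftrightarrow> (\<exists>r. thin_choice I a r) \<and>
     (\<forall>r s. thin_choice I a r \<and> thin_choice I a s \<longrightarrow> thin_sum I r - thin_sum I s \<in> W)"

definition has_large_circuits :: "'a set set \<Rightarrow> bool" where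
  "has_large_circuits E \<longleftrightarrow>
     \<not> (\<exists>R>0. \<forall>vs. circuit E vs \<longrightarrow> circuit_vec vs \<in> C_circ E R)"

lemma thin_sum_in_C_circ:
  fixes I :: "'i set" and c :: "'i \<Rightarrow> 'a list"
  assumes c: "\<forall>i\<in>I. circuit E (c i) \<and> length (c i) \<le> R"
    and t: "thin I (\<lambda>i. circuit_vec (c i))"
  shows "thin_sum I (\<lambda>i. circuit_vec (c i)) \<in> C_circ E R"
proof -
  define J where "J = {i\<in>I. \<exists>e. circuit_vec (c i) e \<noteq> 0}"
  define F where "F i = {j\<in>J. c j = c i}" for i
  define h where "h i = (c i, to_nat_on (F i) i)" for i
  have fin: "finite (F i)" if i: "i \<in> J" for i
  proof -
    obtain e where e: "circuit_vec (c i) e \<noteq> 0" using i by (auto simp: J_def)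
    have "F i \<subseteq> {j\<in>I. circuit_vec (c j) e \<noteq> 0}" using e by (auto simp: F_def J_def)
    then show ?thesis using t finite_subset unfolding thin_def by blast
  qed
  have inj: "inj_on h J"
  proof (rule inj_onI)
    fix i j assume i: "i \<in> J" and j: "j \<in> J" and eq: "h i = h j"
    then have "F i = F j" "to_nat_on (F i) i = to_nat_on (F j) j" by (auto simp: h_def F_def)
    moreover have "i \<in> F i" "j \<in> F j" using i j by (auto simp: F_def)
    ultimately show "i = j"
      using inj_on_to_nat_on[OF countable_finite[OF fin[OF i]]] by (metis inj_onD)
  qed
  have sup: "{p\<in>h ` J. circuit_vec (fst p) e \<noteq> 0} = h ` {i\<in>I. circuit_vec (c i) e \<noteq> 0}" for e
    by (auto simp: h_def J_def)
  have inj': "inj_on h {i\<in>I. circuit_vec (c i) e \<noteq> 0}" for e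
    by (rule inj_on_subset[OF inj]) (auto simp: J_def)
  have "thin (h ` J) (\<lambda>p. circuit_vec (fst p))"
    unfolding thin_def sup using t by (auto simp: thin_def)
  moreover have "thin_sum I (\<lambda>i. circuit_vec (c i)) = thin_sum (h ` J) (\<lambda>p. circuit_vec (fst p))"
    unfolding thin_sum_def sup by (rule ext, subst sum.reindex[OF inj']) (simp add: h_def)
  moreover have "\<forall>p\<in>h ` J. circuit E (fst p) \<and> length (fst p) \<le> R"
    using c by (auto simp: h_def J_def)
  ultimately show ?thesis unfolding C_circ_def by blast
qed

end

theory Submission
  imports Defs "HOL-Analysis.Function_Topology"
begin

text \<open>Everything rests on each \<open>C_circ E R\<close> being a subgroup that is closed in the topology of
  pointwise convergence. Closedness is a compactness argument: only finitely many circuits of length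
  at most \<open>R\<close> meet a given edge, so membership is a system of equations over \<open>\<int>\<^sub>2\<close> with finitely
  many unknowns each, solvable once all its finite subsystems are.

  If all circuits lie in \<open>C_circ E R\<close>, then by closedness so do all of \<open>C_inf E\<close> and all
  thin sums of its members. If there are large circuits, then elements of \<open>C_inf E\<close> that have finite
  support and avoid a given finite edge set are still not contained in any \<open>C_circ E R\<close>. So one picks
  successive summands whose \<open>n\<close>-th partial sum is not in \<open>C_circ E n\<close>; by closedness this is
  witnessed on a finite edge set, which all later summands avoid. The total sum is then in no
  \<open>C_circ E n\<close>.\<close>

text \<open>Rewriting \<open>+\<close> and \<open>*\<close> on \<open>bit\<close> to XOR and AND
  would hide the field structure from the sum and distributivity rules.\<close>

declare add_bit_eq_xor [simp del] mult_bit_eq_and [simp del]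

section \<open>Thin sums\<close>

lemma bit_add_self [simp]: "(b :: bit) + b = 0"
  by (cases b) (simp_all flip: one_add_one)

lemma bit_fun_diff_eq_add: "(x :: 'e \<Rightarrow> bit) - y = x + y"
  by (simp add: fun_eq_iff)

lemma bit_fun_add_cancel: "(x :: 'e \<Rightarrow> bit) + y + y = x"
  by (simp add: fun_eq_iff add.assoc)

lemma thin_sum_eq_sum:
  assumes "finite A" "A \<subseteq> I" "\<And>i. i \<in> I \<Longrightarrow> f i e \<noteq> 0 \<Longrightarrow> i \<in> A"
  shows "thin_sum I f e = (\<Sum>i\<in>A. f i e)"
  unfolding thin_sum_def using assms by (intro sum.mono_neutral_left) auto

lemma thin_zero [simp]: "thin I (\<lambda>i. 0)"
  by (simp add: thin_def)

lemma thin_sum_zero [simp]: "thin_sum I (\<lambda>i. 0) = 0"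
  by (simp add: thin_sum_def fun_eq_iff)

lemma thin_diff:
  assumes "thin I r" "thin I s"
  shows "thin I (\<lambda>i. r i - s i)"
  unfolding thin_def
proof
  fix e
  have "{i\<in>I. (r i - s i) e \<noteq> 0} \<subseteq> {i\<in>I. r i e \<noteq> 0} \<union> {i\<in>I. s i e \<noteq> 0}" by auto
  then show "finite {i\<in>I. (r i - s i) e \<noteq> 0}"
    by (rule finite_subset) (use assms in \<open>simp add: thin_def\<close>)
qed

lemma thin_sum_diff:
  assumes "thin I r" "thin I s"
  shows "thin_sum I (\<lambda>i. r i - s i) = thin_sum I r - thin_sum I s"
proof
  fix e
  let ?A = "{i\<in>I. r i e \<noteq> 0} \<union> {i\<in>I. s i e \<noteq> 0}"
  have A: "finite ?A" "?A \<subseteq> I" using assms by (auto simp: thin_def)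
  have "thin_sum I (\<lambda>i. r i - s i) e = (\<Sum>i\<in>?A. (r i - s i) e)"
    by (rule thin_sum_eq_sum[OF A]) auto
  also have "\<dots> = (\<Sum>i\<in>?A. r i e) - (\<Sum>i\<in>?A. s i e)"
    unfolding fun_diff_def by (rule sum_subtractf)
  also have "\<dots> = thin_sum I r e - thin_sum I s e"
    using thin_sum_eq_sum[OF A, of r e] thin_sum_eq_sum[OF A, of s e] by auto
  finally show "thin_sum I (\<lambda>i. r i - s i) e = (thin_sum I r - thin_sum I s) e" by simp
qed

text \<open>The indices active at some edge of \<open>F\<close> form a finite set. Thus every thin
  sum is a pointwise limit of finite partial sums, which makes closedness applicable to it.\<close>

lemma thin_sum_finite_approx:
  assumes "thin I f" "finite F"
  shows "\<exists>A. finite A \<and> A \<subseteq> I \<and> (\<forall>e\<in>F. (\<Sum>i\<in>A. f i) e = thin_sum I f e)"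
proof (intro exI conjI ballI)
  let ?A = "\<Union>e\<in>F. {i\<in>I. f i e \<noteq> 0}"
  show A: "finite ?A" "?A \<subseteq> I" using assms by (auto simp: thin_def)
  have app: "(\<Sum>i\<in>B. f i) e = (\<Sum>i\<in>B. f i e)" if "finite B" for B e
    using that by (induction B) auto
  fix e assume "e \<in> F"
  then show "(\<Sum>i\<in>?A. f i) e = thin_sum I f e"
    using app[OF A(1)] by (subst thin_sum_eq_sum[OF A]) auto
qed

section \<open>Compactness\<close>

text \<open>Tychonoff: a product of finite discrete spaces is compact. A condition on finitely many
  coordinates cuts out a closed set, so the finite intersection property yields a common
  solution.\<close>

lemma finitely_satisfiable_imp_satisfiable:
  fixes P :: "'e \<Rightarrow> ('k \<Rightarrow> 'b) \<Rightarrow> bool"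
  assumes "finite (UNIV :: 'b set)"
    and fin: "\<And>e. finite (D e)"
    and dep: "\<And>e g h. (\<And>k. k \<in> D e \<Longrightarrow> g k = h k) \<Longrightarrow> P e g \<Longrightarrow> P e h"
    and sat: "\<And>F. finite F \<Longrightarrow> \<exists>g. \<forall>e\<in>F. P e g"
  shows "\<exists>g. \<forall>e. P e g"
proof -
  let ?X = "product_topology (\<lambda>k :: 'k. discrete_topology (UNIV :: 'b set)) UNIV"
  have "compact_space ?X"
    unfolding compact_space_product_topology using assms(1)
    by (simp add: compact_space_def compactin_discrete_topology)
  moreover have "closedin ?X {g. P e g}" for e
  proof -
    have "openin ?X {g. \<not> P e g}"
      unfolding openin_product_topology_alt
    proof
      fix g assume g: "g \<in> {g. \<not> P e g}"
      \<comment> \<open>This basic box freezes the coordinates in \<open>D e\<close>, so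
        \<open>P e\<close> fails on all of it as it does at \<open>g\<close>.\<close>
      let ?U = "\<lambda>k. if k \<in> D e then {g k} else UNIV"
      have "finite {k \<in> UNIV. ?U k \<noteq> topspace (discrete_topology UNIV)}"
        by (rule finite_subset[OF _ fin[of e]]) auto
      moreover have "Pi\<^sub>E UNIV ?U \<subseteq> {g. \<not> P e g}"
      proof
        fix h assume "h \<in> Pi\<^sub>E UNIV ?U"
        then have "h k = g k" if "k \<in> D e" for k
          using that by (auto simp: PiE_iff dest!: spec[of _ k])
        then show "h \<in> {g. \<not> P e g}" using dep[of e h g] g by auto
      qed
      ultimately show "\<exists>U. finite {i \<in> UNIV. U i \<noteq> topspace (discrete_topology UNIV)} \<and>
          (\<forall>i\<in>UNIV. openin (discrete_topology UNIV) (U i)) \<and>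
          g \<in> Pi\<^sub>E UNIV U \<and> Pi\<^sub>E UNIV U \<subseteq> {g. \<not> P e g}"
        by (intro exI[of _ ?U]) auto
    qed
    moreover have "UNIV - {g. P e g} = {g. \<not> P e g}" by auto
    ultimately show ?thesis by (simp add: closedin_def)
  qed
  moreover have "\<Inter>\<F> \<noteq> {}" if \<F>: "finite \<F>" "\<F> \<subseteq> range (\<lambda>e. {g. P e g})" for \<F>
  proof -
    obtain F where "finite F" "\<F> = (\<lambda>e. {g. P e g}) ` F"
      using finite_subset_image[OF \<F>] by blast
    with sat[of F] show ?thesis by auto
  qed
  ultimately have "\<Inter>(range (\<lambda>e. {g. P e g})) \<noteq> {}"
    unfolding compact_space_fip by (elim allE[of _ "range (\<lambda>e. {g. P e g})"]) blast
  then show ?thesis by auto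
qed

section \<open>Short circuits in uniformly locally finite graphs\<close>

definition short_circuits :: "'a set set \<Rightarrow> nat \<Rightarrow> 'a set \<Rightarrow> 'a list set" where
  "short_circuits E R e = {vs. circuit E vs \<and> length vs \<le> R \<and> circuit_vec vs e \<noteq> 0}"

text \<open>Including \<open>S\<close> itself makes the iterates increasing, so \<open>R\<close>
  iterations cover all walks of at most \<open>R\<close> steps.\<close>

definition neighbourhood :: "'a set set \<Rightarrow> 'a set \<Rightarrow> 'a set" where
  "neighbourhood E S = S \<union> \<Union>{e\<in>E. e \<inter> S \<noteq> {}}"

lemma finite_neighbourhood:
  assumes "ulf_graph V E" "finite S"
  shows "finite (neighbourhood E S)"
proof -
  have E: "\<And>e. e \<in> E \<Longrightarrow> e \<subseteq> V \<and> card e = 2"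
    and deg: "\<And>v. v \<in> V \<Longrightarrow> finite {e\<in>E. v \<in> e}"
    using assms(1) by (auto simp: ulf_graph_def simple_graph_def)
  have "{e\<in>E. e \<inter> S \<noteq> {}} = (\<Union>v\<in>S \<inter> V. {e\<in>E. v \<in> e})" using E by blast
  then have "finite {e\<in>E. e \<inter> S \<noteq> {}}" using deg assms(2) by simp
  moreover have "finite e" if "e \<in> E" for e using E[OF that] by (simp add: card_ge_0_finite)
  ultimately show ?thesis using assms(2) by (auto simp: neighbourhood_def)
qed

text \<open>Walking forward along the closed path from position \<open>i\<close> reaches each of its
  vertices in fewer than \<open>length vs\<close> steps.\<close>

lemma circuit_subset_iterated_neighbourhood:
  assumes "circuit E vs" "length vs \<le> R" "i < length vs"
  shows "set vs \<subseteq> (neighbourhood E ^^ R) {vs ! i}"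
proof
  let ?n = "length vs"
  have walk: "vs ! ((i + k) mod ?n) \<in> (neighbourhood E ^^ k) {vs ! i}" for k
  proof (induction k)
    case 0 then show ?case using assms(3) by simp
  next
    case (Suc k)
    let ?j = "(i + k) mod ?n"
    have "?j < ?n" using assms(3) by (intro mod_less_divisor) linarith
    then have "{vs ! ?j, vs ! (Suc ?j mod ?n)} \<in> E" using assms(1) by (auto simp: circuit_def)
    moreover have "Suc ?j mod ?n = (i + Suc k) mod ?n" by (simp add: mod_Suc_eq)
    ultimately show ?case using Suc by (force simp: neighbourhood_def)
  qed
  have mono: "(neighbourhood E ^^ k) S \<subseteq> (neighbourhood E ^^ m) S" if "k \<le> m" for k m S
    using that by (rule lift_Suc_mono_le[rotated]) (auto simp: neighbourhood_def)
  fix v assume "v \<in> set vs"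
  then obtain j where j: "j < ?n" "v = vs ! j" by (auto simp: in_set_conv_nth)
  \<comment> \<open>The number of forward steps from \<open>i\<close> to \<open>j\<close>; the form
    \<open>?n - i\<close> keeps the subtraction of naturals exact.\<close>
  define k where "k = (j + (?n - i)) mod ?n"
  have "(i + k) mod ?n = (i + (j + (?n - i))) mod ?n" unfolding k_def by (rule mod_add_right_eq)
  also have "i + (j + (?n - i)) = j + ?n" using assms(3) by simp
  finally have "(i + k) mod ?n = j" using j by simp
  moreover have "k \<le> R"
    unfolding k_def using mod_less_divisor[of ?n "j + (?n - i)"] assms by linarith
  ultimately show "v \<in> (neighbourhood E ^^ R) {vs ! i}"
    using walk[of k] mono[of k R] j by auto
qed

lemma circuit_vec_nonzeroD:
  assumes "circuit_vec vs e = 1"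
  shows "\<exists>i<length vs. e = {vs ! i, vs ! (Suc i mod length vs)}"
proof (rule ccontr)
  assume "\<not> ?thesis"
  then have none: "{i. i < length vs \<and> {vs ! i, vs ! (Suc i mod length vs)} = e} = {}" by auto
  show False using assms unfolding circuit_vec_def none by simp
qed

text \<open>Such a circuit has a vertex in \<open>e\<close>, hence stays in a finite ball around
  \<open>e\<close>, and a finite set carries only finitely many lists of bounded length.\<close>

lemma finite_short_circuits:
  assumes "ulf_graph V E"
  shows "finite (short_circuits E R e)"
proof (cases "finite e")
  case True
  let ?B = "\<Union>v\<in>e. (neighbourhood E ^^ R) {v}"
  have "finite ((neighbourhood E ^^ k) {v})" for v k
    by (induction k) (auto intro: finite_neighbourhood[OF assms])
  then have "finite ?B" using True by blast
  moreover have "short_circuits E R e \<subseteq> {vs. set vs \<subseteq> ?B \<and> length vs \<le> R}"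
  proof
    fix vs assume vs: "vs \<in> short_circuits E R e"
    then obtain i where "i < length vs" "vs ! i \<in> e"
      using circuit_vec_nonzeroD[of vs e] by (auto simp: short_circuits_def)
    with circuit_subset_iterated_neighbourhood[of E vs R i] vs
    show "vs \<in> {vs. set vs \<subseteq> ?B \<and> length vs \<le> R}" by (auto simp: short_circuits_def)
  qed
  ultimately show ?thesis using finite_lists_length_le finite_subset by blast
next
  case False
  then have "short_circuits E R e = {}"
    using circuit_vec_nonzeroD[of _ e] by (fastforce simp: short_circuits_def)
  then show ?thesis by simp
qed

section \<open>The groups \<open>C_circ E R\<close>\<close>

text \<open>Only the parity of the multiplicity of a circuit counts, so a family amounts to a
  coefficient function \<open>g\<close>. Every \<open>g\<close> is allowed, since
  \<open>finite_short_circuits\<close> makes thinness automatic. Membership becomes a linear system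
  with one equation per coordinate.\<close>

lemma C_circ_iff:
  assumes "ulf_graph V E"
  shows "x \<in> C_circ E R \<longleftrightarrow>
    (\<exists>g. x = (\<lambda>e. \<Sum>k\<in>short_circuits E R e. g k * circuit_vec k e))" (is "_ \<longleftrightarrow> ?rhs")
proof
  assume "x \<in> C_circ E R"
  then obtain I :: "('a list \<times> nat) set" and c
    where c: "\<forall>i\<in>I. circuit E (c i) \<and> length (c i) \<le> R"
      and t: "thin I (\<lambda>i. circuit_vec (c i))"
      and x: "x = thin_sum I (\<lambda>i. circuit_vec (c i))"
    unfolding C_circ_def by blast
  have "x e = (\<Sum>k\<in>short_circuits E R e. of_nat (card {i\<in>I. c i = k}) * circuit_vec k e)" for e
  proof -
    let ?I = "{i\<in>I. circuit_vec (c i) e \<noteq> 0}"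
    have "x e = (\<Sum>k\<in>short_circuits E R e. \<Sum>i\<in>{i. i \<in> ?I \<and> c i = k}. circuit_vec (c i) e)"
      unfolding x thin_sum_def using t c
      by (intro sum.group[symmetric] finite_short_circuits[OF assms])
        (auto simp: thin_def short_circuits_def)
    also have "\<dots> = (\<Sum>k\<in>short_circuits E R e. of_nat (card {i\<in>I. c i = k}) * circuit_vec k e)"
    proof (rule sum.cong[OF refl])
      fix k assume "k \<in> short_circuits E R e"
      then have "{i. i \<in> ?I \<and> c i = k} = {i\<in>I. c i = k}" by (auto simp: short_circuits_def)
      then show "(\<Sum>i\<in>{i. i \<in> ?I \<and> c i = k}. circuit_vec (c i) e) =
          of_nat (card {i\<in>I. c i = k}) * circuit_vec k e"
        by simp
    qed
    finally show ?thesis .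
  qed
  \<comment> \<open>If \<open>k\<close> occurs infinitely often, \<open>card\<close> returns 0. This
    is harmless, as thinness then forces \<open>circuit_vec k = 0\<close>.\<close>
  then show ?rhs by (intro exI[of _ "\<lambda>k. of_nat (card {i\<in>I. c i = k})"]) (rule ext)
next
  assume ?rhs
  then obtain g where x: "x = (\<lambda>e. \<Sum>k\<in>short_circuits E R e. g k * circuit_vec k e)" ..
  let ?I = "{k. circuit E k \<and> length k \<le> R \<and> g k \<noteq> 0}"
  have sub: "{k\<in>?I. circuit_vec k e \<noteq> 0} \<subseteq> short_circuits E R e" for e
    by (auto simp: short_circuits_def)
  have "thin ?I circuit_vec"
    unfolding thin_def using finite_subset[OF sub finite_short_circuits[OF assms]] by blast
  then have "thin_sum ?I circuit_vec \<in> C_circ E R"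
    using thin_sum_in_C_circ[of ?I E "\<lambda>k. k" R] by simp
  moreover have "thin_sum ?I circuit_vec = x"
    unfolding thin_sum_def x
    by (rule ext, rule sum.mono_neutral_cong_left[OF finite_short_circuits[OF assms] sub])
      (auto simp: short_circuits_def)
  ultimately show "x \<in> C_circ E R" by simp
qed

lemma C_circ_add:
  assumes "ulf_graph V E" "x \<in> C_circ E R" "y \<in> C_circ E R"
  shows "x + y \<in> C_circ E R"
proof -
  obtain g h where "x = (\<lambda>e. \<Sum>k\<in>short_circuits E R e. g k * circuit_vec k e)"
    and "y = (\<lambda>e. \<Sum>k\<in>short_circuits E R e. h k * circuit_vec k e)"
    using assms C_circ_iff[OF assms(1)] by meson
  then have "x + y = (\<lambda>e. \<Sum>k\<in>short_circuits E R e. (g k + h k) * circuit_vec k e)"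
    by (simp add: fun_eq_iff sum.distrib distrib_right)
  then show ?thesis unfolding C_circ_iff[OF assms(1)] by (intro exI[of _ "\<lambda>k. g k + h k"])
qed

lemma C_circ_zero [simp]: "0 \<in> C_circ E R"
  using thin_sum_in_C_circ[of "{} :: nat set" E "\<lambda>_. []" R]
  by (simp add: thin_def thin_sum_def zero_fun_def)

lemma C_circ_sum:
  assumes "ulf_graph V E" "finite A" "\<And>i. i \<in> A \<Longrightarrow> f i \<in> C_circ E R"
  shows "(\<Sum>i\<in>A. f i) \<in> C_circ E R"
  using assms(2,3) by (induction A) (auto intro: C_circ_add[OF assms(1)])

lemma C_circ_mono: "R \<le> R' \<Longrightarrow> C_circ E R \<subseteq> C_circ E R'"
  unfolding C_circ_def by (smt (verit, best) Collect_mono order_trans)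

lemma C_circ_add_max:
  assumes "ulf_graph V E" "x \<in> C_circ E R" "y \<in> C_circ E R'"
  shows "x + y \<in> C_circ E (max R R')"
  using assms C_circ_mono[of R "max R R'" E] C_circ_mono[of R' "max R R'" E]
  by (intro C_circ_add[OF assms(1)]) auto

text \<open>An element \<open>y\<close> that agrees with \<open>x\<close> on \<open>F\<close>
  supplies coefficients solving the equations at \<open>F\<close>. Each equation has finitely many
  unknowns, so compactness gives one \<open>g\<close> for all of them.\<close>

lemma C_circ_closed:
  assumes "ulf_graph V E"
    and approx: "\<And>F. finite F \<Longrightarrow> \<exists>y\<in>C_circ E R. \<forall>e\<in>F. y e = x e"
  shows "x \<in> C_circ E R"
proof -
  have "\<exists>g. \<forall>e. x e = (\<Sum>k\<in>short_circuits E R e. g k * circuit_vec k e)"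
  proof (rule finitely_satisfiable_imp_satisfiable[where D = "short_circuits E R" and
        P = "\<lambda>e g. x e = (\<Sum>k\<in>short_circuits E R e. g k * circuit_vec k e)"])
    fix F :: "'a set set" assume "finite F"
    then obtain y where y: "y \<in> C_circ E R" "\<forall>e\<in>F. y e = x e" using approx by blast
    from y(1) obtain g where "y = (\<lambda>e. \<Sum>k\<in>short_circuits E R e. g k * circuit_vec k e)"
      unfolding C_circ_iff[OF assms(1)] ..
    with y(2) show "\<exists>g. \<forall>e\<in>F. x e = (\<Sum>k\<in>short_circuits E R e. g k * circuit_vec k e)"
      by (intro exI[of _ g]) simp
  next
    have "(UNIV :: bit set) = {0, 1}" by auto
    then show "finite (UNIV :: bit set)" by (metis finite.emptyI finite.insertI)
  qed (use finite_short_circuits[OF assms(1)] in \<open>auto cong: sum.cong\<close>)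
  then show ?thesis unfolding C_circ_iff[OF assms(1)] by (auto simp: fun_eq_iff)
qed

text \<open>Pooling the circuit families of all \<open>f i\<close> need not give a thin family.
  Instead, on each finite set the total agrees with a finite partial sum, which lies in
  \<open>C_circ E R\<close>, and closedness applies.\<close>

lemma C_circ_thin_sum:
  assumes "ulf_graph V E" "thin I f" "\<And>i. i \<in> I \<Longrightarrow> f i \<in> C_circ E R"
  shows "thin_sum I f \<in> C_circ E R"
proof (rule C_circ_closed[OF assms(1)])
  fix F :: "'a set set" assume "finite F"
  from thin_sum_finite_approx[OF assms(2) this] obtain A
    where "finite A" "A \<subseteq> I" "\<forall>e\<in>F. (\<Sum>i\<in>A. f i) e = thin_sum I f e" by blast
  then show "\<exists>y\<in>C_circ E R. \<forall>e\<in>F. y e = thin_sum I f e"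
    using C_circ_sum[OF assms(1), of A f R] assms(3) by blast
qed

lemma C_inf_zero [simp]: "0 \<in> C_inf E"
  by (auto simp: C_inf_def)

lemma C_inf_add:
  assumes "ulf_graph V E" "x \<in> C_inf E" "y \<in> C_inf E"
  shows "x + y \<in> C_inf E"
  using assms(2,3) C_circ_add_max[OF assms(1)] unfolding C_inf_def by blast

lemma C_inf_coset_diff:
  assumes "ulf_graph V E" "x \<in> z +o C_inf E" "y \<in> z +o C_inf E"
  shows "x - y \<in> C_inf E"
proof -
  obtain u w where "u \<in> C_inf E" "w \<in> C_inf E" "x = z + u" "y = z + w"
    using assms by (auto simp: elt_set_plus_def)
  moreover have "(z + u) - (z + w) = u + w"
    unfolding add_diff_cancel_left by (rule bit_fun_diff_eq_add)
  ultimately show ?thesis using C_inf_add[OF assms(1), of u w] by metis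
qed

lemma circuit_vec_in_C_circ: "circuit E vs \<Longrightarrow> circuit_vec vs \<in> C_circ E (length vs)"
  using thin_sum_in_C_circ[of "{0 :: nat}" E "\<lambda>_. vs" "length vs"]
    thin_sum_eq_sum[of "{0 :: nat}" "{0}" "\<lambda>_. circuit_vec vs"]
  by (simp add: thin_def ext[of "thin_sum {0} (\<lambda>_. circuit_vec vs)" "circuit_vec vs"])

lemma finite_support_circuit_vec: "finite {e. circuit_vec vs e \<noteq> 0}"
  by (rule finite_subset[of _ "(\<lambda>i. {vs ! i, vs ! (Suc i mod length vs)}) ` {..<length vs}"])
    (auto dest!: circuit_vec_nonzeroD)

section \<open>Consistency\<close>

text \<open>A uniform bound \<open>R\<close> puts all of \<open>C_inf E\<close> into the single
  group \<open>C_circ E R\<close>. It contains the termwise differences of two thin choices and is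
  closed under thin sums.\<close>

lemma consistent_if_no_large_circuits:
  assumes ulf: "ulf_graph V E" and "\<not> has_large_circuits E"
    and a: "\<forall>i\<in>I. a i \<in> H1_uf V E" and "\<exists>r. thin_choice I a r"
  shows "consistent_sum (C_inf E) I a"
proof -
  obtain R where R: "\<And>vs. circuit E vs \<Longrightarrow> circuit_vec vs \<in> C_circ E R"
    using assms(2) by (auto simp: has_large_circuits_def)
  have C_inf_sub: "x \<in> C_circ E R" if "x \<in> C_inf E" for x
  proof -
    obtain R' where "x \<in> C_circ E R'" using \<open>x \<in> C_inf E\<close> by (auto simp: C_inf_def)
    then obtain I :: "('a list \<times> nat) set" and c
      where "\<forall>i\<in>I. circuit E (c i) \<and> length (c i) \<le> R'"
        and "thin I (\<lambda>i. circuit_vec (c i))"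
        and "x = thin_sum I (\<lambda>i. circuit_vec (c i))"
      unfolding C_circ_def by blast
    then show ?thesis using C_circ_thin_sum[OF ulf, of I "\<lambda>i. circuit_vec (c i)" R] R by simp
  qed
  have "thin_sum I r - thin_sum I s \<in> C_inf E" if r: "thin_choice I a r" and s: "thin_choice I a s"
    for r s
  proof -
    have "r i - s i \<in> C_circ E R" if i: "i \<in> I" for i
    proof -
      obtain z where "a i = z +o C_inf E" using a i by (auto simp: H1_uf_def)
      then show ?thesis
        using C_inf_sub C_inf_coset_diff[OF ulf, of "r i" z "s i"] r s i
        by (auto simp: thin_choice_def)
    qed
    moreover have "thin I r" "thin I s" using r s by (auto simp: thin_choice_def)
    ultimately have "thin_sum I r - thin_sum I s \<in> C_circ E R"
      using C_circ_thin_sum[OF ulf thin_diff[of I r s]] thin_sum_diff[of I r s] by simp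
    then show ?thesis by (auto simp: C_inf_def)
  qed
  then show ?thesis using assms(4) by (auto simp: consistent_sum_def)
qed

text \<open>Gaussian elimination along \<open>F\<close>: where possible, a pivot \<open>z\<close>
  clears the new coordinate \<open>f\<close>. The bound \<open>R\<close> stays arbitrary because the
  induction hypothesis is used at a bound that also covers \<open>z\<close>.\<close>

lemma large_elements_avoiding:
  assumes ulf: "ulf_graph V E" and large: "has_large_circuits E" and "finite F"
  shows "\<exists>x\<in>C_inf E. finite {e. x e \<noteq> 0} \<and> (\<forall>e\<in>F. x e = 0) \<and> x \<notin> C_circ E R"
  using \<open>finite F\<close>
proof (induction F arbitrary: R)
  case empty
  \<comment> \<open>\<open>Suc R\<close> is used because the definition quantifies over positive
    bounds.\<close>
  obtain vs where vs: "circuit E vs" "circuit_vec vs \<notin> C_circ E (Suc R)"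
    using large by (auto simp: has_large_circuits_def)
  moreover have "circuit_vec vs \<in> C_inf E" using circuit_vec_in_C_circ[OF vs(1)] by (auto simp: C_inf_def)
  ultimately show ?case
    using C_circ_mono[of R "Suc R" E] finite_support_circuit_vec[of vs] by auto
next
  case (insert f F)
  let ?Z = "{x \<in> C_inf E. finite {e. x e \<noteq> 0} \<and> (\<forall>e\<in>F. x e = 0)}"
  show ?case
  proof (cases "\<exists>z\<in>?Z. z f \<noteq> 0")
    case True
    then obtain z where z: "z \<in> ?Z" "z f \<noteq> 0" by blast
    obtain R0 where R0: "z \<in> C_circ E R0" using z by (auto simp: C_inf_def)
    \<comment> \<open>The pivot is fixed before \<open>x\<close>, so \<open>x\<close> can be taken
      outside a group that contains \<open>z\<close>; adding \<open>z\<close> then cannot bring it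
      into \<open>C_circ E R\<close>.\<close>
    let ?m = "max R R0"
    obtain x where x: "x \<in> ?Z" "x \<notin> C_circ E ?m" using insert.IH[of ?m] by blast
    show ?thesis
    proof (cases "x f = 0")
      case True
      then show ?thesis using x C_circ_mono[of R ?m E] by auto
    next
      case False
      have "x + z \<in> C_inf E" using x z C_inf_add[OF ulf] by blast
      moreover have "finite {e. (x + z) e \<noteq> 0}"
        by (rule finite_subset[of _ "{e. x e \<noteq> 0} \<union> {e. z e \<noteq> 0}"]) (use x z in auto)
      moreover have "\<forall>e\<in>insert f F. (x + z) e = 0" using False x z by auto
      moreover have "x + z \<notin> C_circ E R"
      proof
        assume "x + z \<in> C_circ E R"
        then have "(x + z) + z \<in> C_circ E ?m"
          using R0 by (rule C_circ_add_max[OF ulf])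
        moreover have "(x + z) + z = x" by (rule bit_fun_add_cancel)
        ultimately show False using x by simp
      qed
      ultimately show ?thesis by blast
    qed
  next
    case False
    then show ?thesis using insert.IH[of R] by auto
  qed
qed

text \<open>Adding a suitable \<open>x\<close> that vanishes on \<open>F\<close> keeps the values of
  \<open>s\<close> there and moves the sum out of \<open>C_circ E n\<close>. The set
  \<open>F'\<close> collects the supports and a finite witness of non-membership.\<close>

lemma extend_partial_sum:
  assumes ulf: "ulf_graph V E" and large: "has_large_circuits E"
    and s: "s \<in> C_inf E" "\<forall>e. e \<notin> F \<longrightarrow> s e = 0" and F: "finite F"
  shows "\<exists>s' F'. s' \<in> C_inf E \<and> (\<forall>e. e \<notin> F' \<longrightarrow> s' e = 0) \<and> finite F' \<and>
    (\<forall>y\<in>C_circ E n. \<exists>e\<in>F'. y e \<noteq> s' e) \<and> F \<subseteq> F' \<and> (\<forall>e\<in>F. s' e = s e)"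
proof -
  obtain R where R: "s \<in> C_circ E R" using s by (auto simp: C_inf_def)
  let ?m = "max n R"
  obtain x where x: "x \<in> C_inf E" "finite {e. x e \<noteq> 0}" "\<forall>e\<in>F. x e = 0" "x \<notin> C_circ E ?m"
    using large_elements_avoiding[OF ulf large F] by blast
  have "x + s \<notin> C_circ E n"
  proof
    assume "x + s \<in> C_circ E n"
    then have "(x + s) + s \<in> C_circ E ?m"
      using R by (rule C_circ_add_max[OF ulf])
    moreover have "(x + s) + s = x" by (rule bit_fun_add_cancel)
    ultimately show False using x by simp
  qed
  \<comment> \<open>Closedness read backwards: non-membership is visible on a finite set.\<close>
  then obtain G where G: "finite G" "\<forall>y\<in>C_circ E n. \<exists>e\<in>G. y e \<noteq> (x + s) e"
    using C_circ_closed[OF ulf, of n "x + s"] by blast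
  show ?thesis
  proof (intro exI conjI)
    show "x + s \<in> C_inf E" using x s C_inf_add[OF ulf] by blast
    show "finite (F \<union> {e. x e \<noteq> 0} \<union> G)" using F x G by simp
  qed (use x s G in auto)
qed

text \<open>The partial sums \<open>s n\<close> are frozen on growing finite sets
  \<open>F n\<close>. The total agrees with \<open>s n\<close> on \<open>F n\<close>, where
  \<open>s n\<close> already differs from every member of \<open>C_circ E n\<close>, so it lies in
  none of these groups.\<close>

lemma inconsistent_if_large_circuits:
  assumes ulf: "ulf_graph V E" and large: "has_large_circuits E"
  shows "\<exists>c :: nat \<Rightarrow> _. (\<forall>i. c i \<in> C_inf E) \<and> thin UNIV c \<and> thin_sum UNIV c \<notin> C_inf E"
proof -
  define P where "P n p \<longleftrightarrow> fst p \<in> C_inf E \<and> (\<forall>e. e \<notin> snd p \<longrightarrow> fst p e = 0) \<and> finite (snd p) \<and>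
    (\<forall>y\<in>C_circ E n. \<exists>e\<in>snd p. y e \<noteq> fst p e)" for n and p :: "('a set \<Rightarrow> bit) \<times> 'a set set"
  define Q where "Q p q \<longleftrightarrow> snd p \<subseteq> snd q \<and> (\<forall>e\<in>snd p. fst q e = fst p e)"
    for p q :: "('a set \<Rightarrow> bit) \<times> 'a set set"
  have "\<exists>f. \<forall>n. P n (f n) \<and> Q (f n) (f (Suc n))"
  proof (rule dependent_nat_choice)
    show "\<exists>p. P 0 p"
      using extend_partial_sum[OF ulf large, of 0 "{}" 0] by (auto simp: P_def)
    show "\<exists>q. P (Suc n) q \<and> Q p q" if "P n p" for n p
      using extend_partial_sum[OF ulf large, of "fst p" "snd p" "Suc n"] that
      unfolding P_def Q_def by (metis fst_conv snd_conv)
  qed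
  then obtain f where f: "\<And>n. P n (f n)" "\<And>n. Q (f n) (f (Suc n))" by blast
  define s F where "s n = fst (f n)" and "F n = snd (f n)" for n
  have s: "s n \<in> C_inf E" "e \<notin> F n \<Longrightarrow> s n e = 0"
      "y \<in> C_circ E n \<Longrightarrow> \<exists>e\<in>F n. y e \<noteq> s n e" for n e y
    using f(1)[of n] by (auto simp: P_def s_def F_def)
  have step: "F n \<subseteq> F (Suc n)" "e \<in> F n \<Longrightarrow> s (Suc n) e = s n e" for n e
    using f(2)[of n] by (auto simp: Q_def s_def F_def)
  have F_mono: "F n \<subseteq> F m" if "n \<le> m" for n m
    using that by (rule lift_Suc_mono_le[of F, rotated]) (rule step)
  \<comment> \<open>Consecutive differences, so that \<open>c 0\<close> to \<open>c n\<close>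
    telescope to \<open>s n\<close>.\<close>
  define c where "c n = (case n of 0 \<Rightarrow> s 0 | Suc m \<Rightarrow> s (Suc m) - s m)" for n
  have c_in: "c n \<in> C_inf E" for n
    using s(1) C_inf_add[OF ulf] by (auto simp: c_def bit_fun_diff_eq_add split: nat.split)
  have c_zero: "c m e = 0" if "e \<in> F n" "n < m" for n m e
    using that step(2)[of e "m - 1"] F_mono[of n "m - 1"] by (cases m) (auto simp: c_def)
  have thin: "thin UNIV c"
    unfolding thin_def
  proof
    fix e
    show "finite {i \<in> UNIV. c i e \<noteq> 0}"
    proof (cases "\<exists>n. e \<in> F n")
      case True
      then obtain n where "e \<in> F n" by blast
      then have "{i \<in> UNIV. c i e \<noteq> 0} \<subseteq> {..n}" using c_zero[of e n] by (auto simp: not_less[symmetric])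
      then show ?thesis using finite_subset by blast
    next
      case False
      then have "c i e = 0" for i using s(2) by (auto simp: c_def split: nat.split)
      then show ?thesis by simp
    qed
  qed
  have total: "thin_sum UNIV c e = s n e" if "e \<in> F n" for n e
  proof -
    have "thin_sum UNIV c e = (\<Sum>i\<in>{..n}. c i e)"
      using c_zero[OF that] by (intro thin_sum_eq_sum) (auto simp: not_less[symmetric])
    also have "\<dots> = s n e" by (induction n) (auto simp: c_def add.assoc[symmetric] add.commute)
    finally show ?thesis .
  qed
  have "thin_sum UNIV c \<notin> C_inf E"
  proof
    assume "thin_sum UNIV c \<in> C_inf E"
    then obtain n where "thin_sum UNIV c \<in> C_circ E n" by (auto simp: C_inf_def)
    then show False using s(3) total by blast
  qed
  then show ?thesis using c_in thin by blast
qed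

theorem theorem4p10:
  fixes V :: "'a set" and E :: "'a set set"
  assumes "ulf_graph V E"
  shows "(consistent_sum (C_inf E) (UNIV :: nat set) (\<lambda>i. 0 +o C_inf E)
            \<longleftrightarrow> \<not> has_large_circuits E) \<and>
         (\<not> has_large_circuits E
            \<longleftrightarrow> (\<forall>(I :: nat set) (a :: nat \<Rightarrow> ('a set \<Rightarrow> bit) set).
                  (\<forall>i\<in>I. a i \<in> H1_uf V E) \<and> (\<exists>r. thin_choice I a r)
                  \<longrightarrow> consistent_sum (C_inf E) I a))"
    (is "(?one \<longleftrightarrow> ?two) \<and> (_ \<longleftrightarrow> ?three)")
proof -
  \<comment> \<open>The reference choice with sum 0: under (1), comparison with it forces the sum of
    any other thin choice into \<open>C_inf E\<close>.\<close>
  have zero_choice: "thin_choice (UNIV :: nat set) (\<lambda>i. 0 +o C_inf E) (\<lambda>i. 0)"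
    by (simp add: thin_choice_def elt_set_plus_def)
  have "?one \<Longrightarrow> ?two"
  proof
    assume ?one and "has_large_circuits E"
    from inconsistent_if_large_circuits[OF assms this(2)] obtain c :: "nat \<Rightarrow> _"
      where c: "\<forall>i. c i \<in> C_inf E" "thin UNIV c" "thin_sum UNIV c \<notin> C_inf E" by blast
    then have "thin_choice UNIV (\<lambda>i. 0 +o C_inf E) c"
      by (simp add: thin_choice_def elt_set_plus_def)
    with \<open>?one\<close> zero_choice have "thin_sum UNIV c - thin_sum (UNIV :: nat set) (\<lambda>i. 0) \<in> C_inf E"
      unfolding consistent_sum_def by blast
    then show False using c by simp
  qed
  moreover have "?two \<Longrightarrow> ?three" using consistent_if_no_large_circuits[OF assms] by blast
  moreover have "?three \<Longrightarrow> ?one"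
  proof -
    assume three: ?three
    \<comment> \<open>Since 0 is a cycle, (1) is the instance of (3) with index set
      \<open>UNIV\<close> and all classes zero.\<close>
    have "0 +o C_inf E \<in> H1_uf V E"
      unfolding H1_uf_def by (rule imageI) (simp add: Z1_suf_def)
    then show ?one
      using zero_choice by (intro three[rule_format, OF conjI]) (rule ballI, simp, rule exI)
  qed
  ultimately show ?thesis by blast
qed

end
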